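(* Let $M$ be a finitely presented special monoid. Then $M$ has regular word problem if and only if $M$ is a finite group.
   Context: A monoid is special if it admits a monoid presentation in which every defining relation is of the form $w=1$; a finitely presented special monoid is one given by a finite presentation $\langle A \mid w_1=1,\dots,w_k=1\rangle$ (with $A$ finite). For a word $w=a_1\cdots a_n$, $w^{\mathrm{rev}}=a_n\cdots a_1$. For a monoid $M$ generated (as a monoid) by a finite set $A$, the word problem is the language $\mathrm{WP}_A^M=\{u\# v^{\mathrm{rev}} \mid u,v\in A^*,\ u=_M v\}$, where $\#\notin A$ and $u=_M v$ means that $u,v$ represent the same element of $M$. $M$ has regular word problem if $\mathrm{WP}_A^M$ is a regular language; this does not depend on the choice of finite generating set $A$. *)

theory Defs
  imports "HOL-Algebra.Group"
begin

inductive_set pres_cong :: "'a set \<Rightarrow> ('a list \<times> 'a list) set \<Rightarrow> ('a list \<times> 'a list) set"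
  for A :: "'a set" and R :: "('a list \<times> 'a list) set"
where
  base: "(u, v) \<in> R \<Longrightarrow> u \<in> lists A \<Longrightarrow> v \<in> lists A \<Longrightarrow> (u, v) \<in> pres_cong A R"
| refl: "u \<in> lists A \<Longrightarrow> (u, u) \<in> pres_cong A R"
| sym: "(u, v) \<in> pres_cong A R \<Longrightarrow> (v, u) \<in> pres_cong A R"
| trans: "(u, v) \<in> pres_cong A R \<Longrightarrow> (v, w) \<in> pres_cong A R \<Longrightarrow> (u, w) \<in> pres_cong A R"
| append: "(u, v) \<in> pres_cong A R \<Longrightarrow> (u', v') \<in> pres_cong A R \<Longrightarrow>
             (u @ u', v @ v') \<in> pres_cong A R"

text \<open>The monoid presented by generators \<open>A\<close> and defining relations \<open>u = v\<close> for
  \<open>(u, v) \<in> R\<close>: the free monoid \<open>lists A\<close> modulo the least congruence containing \<open>R\<close>.\<close>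

definition presented_monoid :: "'a set \<Rightarrow> ('a list \<times> 'a list) set \<Rightarrow> 'a list set monoid"
where
  "presented_monoid A R =
     \<lparr> carrier = lists A // pres_cong A R,
       mult = (\<lambda>P Q. \<Union>p\<in>P. \<Union>q\<in>Q. pres_cong A R `` {p @ q}),
       one = pres_cong A R `` {[]} \<rparr>"

definition word_value :: "('m, 'b) monoid_scheme \<Rightarrow> ('x \<Rightarrow> 'm) \<Rightarrow> 'x list \<Rightarrow> 'm"
where
  "word_value M \<sigma> w = foldr (mult M) (map \<sigma> w) (one M)"

text \<open>A generating set is an alphabet \<open>X\<close> with an interpretation \<open>\<sigma>\<close> of its letters in \<open>M\<close>.
  Since \<open>\<sigma>\<close> need not be injective, this covers both subsets of \<open>carrier M\<close> (with
  \<open>\<sigma> = id\<close>) and the generators of a presentation, distinct ones of which may be equal in \<open>M\<close>.\<close>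

definition generates_monoid :: "('m, 'b) monoid_scheme \<Rightarrow> 'x set \<Rightarrow> ('x \<Rightarrow> 'm) \<Rightarrow> bool"
where
  "generates_monoid M X \<sigma> \<longleftrightarrow>
     \<sigma> ` X \<subseteq> carrier M \<and> (\<forall>m \<in> carrier M. \<exists>w \<in> lists X. word_value M \<sigma> w = m)"

text \<open>The letters of \<open>X\<close> are tagged with \<^const>\<open>Some\<close>, and \<^const>\<open>None\<close> is the separator \<open>#\<close>.\<close>

definition word_problem ::
  "('m, 'b) monoid_scheme \<Rightarrow> 'x set \<Rightarrow> ('x \<Rightarrow> 'm) \<Rightarrow> 'x option list set"
where
  "word_problem M X \<sigma> =
     {map Some u @ [None] @ map Some (rev v) | u v.
        u \<in> lists X \<and> v \<in> lists X \<and> word_value M \<sigma> u = word_value M \<sigma> v}"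

text \<open>Recognisability by a complete deterministic finite automaton over the alphabet
  \<open>\<Sigma>\<close>. Naming the finitely many states by natural numbers loses no generality.\<close>

definition regular_language :: "'c set \<Rightarrow> 'c list set \<Rightarrow> bool"
where
  "regular_language \<Sigma> L \<longleftrightarrow>
     finite \<Sigma> \<and>
     (\<exists>(Q :: nat set) q0 F \<delta>.
        finite Q \<and> q0 \<in> Q \<and> F \<subseteq> Q \<and> (\<forall>q \<in> Q. \<forall>c \<in> \<Sigma>. \<delta> q c \<in> Q) \<and>
        L = {w \<in> lists \<Sigma>. foldl \<delta> q0 w \<in> F})"

end

theory Submission
  imports Defs
begin

text \<open>
  Reading \<open>u#\<close> brings an automaton for the word problem into a state that determines the element
  represented by \<open>u\<close>, as \<open>u # u\<^sup>r\<^sup>e\<^sup>v\<close> is accepted; hence regularity means that \<open>M\<close> is finite.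
  Suppose \<open>M\<close> is finite and let \<open>a\<close> be a generator of a special presentation. If \<open>a\<close> occurred in
  no relator, the number of its occurrences would be an invariant of words and the powers of \<open>a\<close>
  would be distinct. So \<open>x a y = 1\<close> for some \<open>x\<close> and \<open>y\<close>, and in a finite monoid
  one-sided inverses are two-sided, whence \<open>a\<close> is a unit.
\<close>

section \<open>Finite monoids\<close>

text \<open>Since \<open>x\<close> undoes it, left multiplication by \<open>y\<close> is injective,
  hence onto by finiteness. So \<open>y\<close> has a right inverse \<open>z\<close>, and cancelling
  \<open>y\<close> with \<open>x\<close> gives \<open>x = z\<close>.\<close>

lemma finite_monoid_left_inverse:
  assumes "monoid M" "finite (carrier M)"
    and x: "x \<in> carrier M" and y: "y \<in> carrier M" and xy: "x \<otimes>\<^bsub>M\<^esub> y = \<one>\<^bsub>M\<^esub>"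
  shows "y \<otimes>\<^bsub>M\<^esub> x = \<one>\<^bsub>M\<^esub>"
proof -
  interpret monoid M by fact
  have cancel: "x \<otimes>\<^bsub>M\<^esub> (y \<otimes>\<^bsub>M\<^esub> z) = z" if "z \<in> carrier M" for z
    using that x y xy by (metis m_assoc l_one)
  have "inj_on (\<lambda>z. y \<otimes>\<^bsub>M\<^esub> z) (carrier M)"
    by (rule inj_on_inverseI[where g = "\<lambda>z. x \<otimes>\<^bsub>M\<^esub> z"]) (rule cancel)
  then have "(\<lambda>z. y \<otimes>\<^bsub>M\<^esub> z) ` carrier M = carrier M"
    using assms(2) y by (intro endo_inj_surj) auto
  then obtain z where z: "z \<in> carrier M" "y \<otimes>\<^bsub>M\<^esub> z = \<one>\<^bsub>M\<^esub>"
    using one_closed by (metis imageE)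
  then have "x = z"
    using cancel[of z] x by simp
  with z show ?thesis by simp
qed

lemma finite_monoid_factors_Units:
  assumes "monoid M" "finite (carrier M)"
    and "x \<in> carrier M" "y \<in> carrier M" "x \<otimes>\<^bsub>M\<^esub> y = \<one>\<^bsub>M\<^esub>"
  shows "x \<in> Units M" "y \<in> Units M"
  using finite_monoid_left_inverse[OF assms] assms(3-5) by (auto simp: Units_def)

text \<open>Turning the one-sided inverse \<open>x\<close> of the product of \<open>a\<close> and
  \<open>y\<close> around exhibits the product of \<open>y\<close> and \<open>x\<close> as a right
  inverse of \<open>a\<close>; finiteness then makes that one two-sided as well.\<close>

lemma finite_monoid_middle_Unit:
  assumes "monoid M" "finite (carrier M)"
    and x: "x \<in> carrier M" and a: "a \<in> carrier M" and y: "y \<in> carrier M"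
    and xay: "x \<otimes>\<^bsub>M\<^esub> (a \<otimes>\<^bsub>M\<^esub> y) = \<one>\<^bsub>M\<^esub>"
  shows "a \<in> Units M"
proof -
  interpret monoid M by fact
  have "(a \<otimes>\<^bsub>M\<^esub> y) \<otimes>\<^bsub>M\<^esub> x = \<one>\<^bsub>M\<^esub>"
    using finite_monoid_left_inverse[OF assms(1,2) x _ xay] a y by simp
  then have "a \<otimes>\<^bsub>M\<^esub> (y \<otimes>\<^bsub>M\<^esub> x) = \<one>\<^bsub>M\<^esub>"
    using a x y by (simp add: m_assoc)
  then show ?thesis
    using finite_monoid_factors_Units(1)[OF assms(1,2) a] x y by blast
qed

section \<open>Presented monoids\<close>

lemma pres_cong_lists:
  "(u, v) \<in> pres_cong A R \<Longrightarrow> u \<in> lists A \<and> v \<in> lists A"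
  by (induction rule: pres_cong.induct) auto

lemma equiv_pres_cong: "equiv (lists A) (pres_cong A R)"
proof (rule equivI)
  show "pres_cong A R \<subseteq> lists A \<times> lists A"
    using pres_cong_lists by (metis SigmaI subrelI)
  show "refl_on (lists A) (pres_cong A R)"
    by (auto simp: refl_on_def intro: pres_cong.refl)
  show "sym_on UNIV (pres_cong A R)"
    by (auto simp: sym_def intro: pres_cong.sym)
  show "trans_on UNIV (pres_cong A R)"
    by (auto simp: trans_def intro: pres_cong.trans)
qed

lemma pres_cong_class_eq_iff:
  assumes "u \<in> lists A" "v \<in> lists A"
  shows "pres_cong A R `` {u} = pres_cong A R `` {v} \<longleftrightarrow> (u, v) \<in> pres_cong A R"
  using eq_equiv_class_iff[OF equiv_pres_cong assms] .

text \<open>The union defining \<open>mult\<close> runs over all representatives; by compatibility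
  with concatenation each contributes the same class.\<close>

lemma presented_monoid_mult_class:
  assumes "u \<in> lists A" "v \<in> lists A"
  shows "pres_cong A R `` {u} \<otimes>\<^bsub>presented_monoid A R\<^esub> pres_cong A R `` {v}
    = pres_cong A R `` {u @ v}"
proof -
  have "pres_cong A R `` {p @ q} = pres_cong A R `` {u @ v}"
    if "(u, p) \<in> pres_cong A R" "(v, q) \<in> pres_cong A R" for p q
    using pres_cong.append[OF that] equiv_class_eq[OF equiv_pres_cong] by metis
  then have "(\<Union>p\<in>pres_cong A R `` {u}. \<Union>q\<in>pres_cong A R `` {v}. pres_cong A R `` {p @ q})
      = (\<Union>p\<in>pres_cong A R `` {u}. \<Union>q\<in>pres_cong A R `` {v}. pres_cong A R `` {u @ v})"
    by (intro SUP_cong HOL.refl) blast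
  \<comment> \<open>Both index sets must be nonempty for the union of a constant family to be that
    constant.\<close>
  moreover have "u \<in> pres_cong A R `` {u}" "v \<in> pres_cong A R `` {v}"
    using assms by (auto intro: pres_cong.refl)
  ultimately show ?thesis
    unfolding presented_monoid_def by (simp only: monoid.simps) blast
qed

text \<open>An isomorphism in the sense of \<^const>\<open>is_iso\<close> is only required to be multiplicative;
  being onto, it nevertheless preserves the unit.\<close>

lemma presented_monoid_isoE:
  assumes "monoid M" "presented_monoid A R \<cong> M"
  obtains \<phi> where
    "\<phi> ` lists A = carrier M" "\<phi> [] = \<one>\<^bsub>M\<^esub>"
    "\<And>u v. u \<in> lists A \<Longrightarrow> v \<in> lists A \<Longrightarrow> \<phi> (u @ v) = \<phi> u \<otimes>\<^bsub>M\<^esub> \<phi> v"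
    "\<And>u v. u \<in> lists A \<Longrightarrow> v \<in> lists A \<Longrightarrow> \<phi> u = \<phi> v \<longleftrightarrow> (u, v) \<in> pres_cong A R"
proof -
  interpret monoid M by fact
  let ?P = "presented_monoid A R"
  let ?c = "\<lambda>w. pres_cong A R `` {w}"
  obtain h where h: "h \<in> hom ?P M" "bij_betw h (carrier ?P) (carrier M)"
    using assms(2) by (auto simp: is_iso_def iso_def)
  define \<phi> where "\<phi> = (\<lambda>w. h (?c w))"
  have carrier: "carrier ?P = ?c ` lists A"
    by (auto simp: presented_monoid_def quotient_def)
  have onto: "\<phi> ` lists A = carrier M"
    using h(2) by (auto simp: \<phi>_def carrier bij_betw_def image_image)
  have mult: "\<phi> (u @ v) = \<phi> u \<otimes>\<^bsub>M\<^esub> \<phi> v" if "u \<in> lists A" "v \<in> lists A" for u v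
    using hom_mult[OF h(1), of "?c u" "?c v"] that
    by (simp add: \<phi>_def carrier presented_monoid_mult_class)
  have "\<phi> u = \<phi> v \<longleftrightarrow> (u, v) \<in> pres_cong A R" if "u \<in> lists A" "v \<in> lists A" for u v
    using inj_on_eq_iff[OF bij_betw_imp_inj_on[OF h(2)], of "?c u" "?c v"] that
    by (simp add: \<phi>_def carrier pres_cong_class_eq_iff)
  moreover have "\<phi> [] = \<one>\<^bsub>M\<^esub>"
  proof -
    \<comment> \<open>Applying \<open>mult\<close> to \<open>[] @ w\<close> turns a preimage
      \<open>w\<close> of the unit into an equation that forces \<open>\<phi> []\<close> to be the
      unit.\<close>
    obtain w where w: "w \<in> lists A" "\<phi> w = \<one>\<^bsub>M\<^esub>"
      using onto one_closed by (metis imageE)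
    have "\<phi> [] \<in> carrier M" using onto by blast
    then show ?thesis
      using mult[of "[]" w] w by simp
  qed
  ultimately show thesis
    using that onto mult by blast
qed

section \<open>Finite special monoids\<close>

lemma pres_cong_count_list:
  assumes "(u, v) \<in> pres_cong A R" "\<And>u v. (u, v) \<in> R \<Longrightarrow> count_list u a = count_list v a"
  shows "count_list u a = count_list v a"
  using assms(1)
proof (induction rule: pres_cong.induct)
  \<comment> \<open>Occurrence counts add up under concatenation, so the closure rules preserve
    their equality; only the defining relations call on the assumption.\<close>
  case (base u v)
  then show ?case using assms(2) by blast
qed simp_all

lemma finite_special_monoid_group:
  assumes "monoid M" and W: "W \<subseteq> lists A"
    and iso: "presented_monoid A (W \<times> {[]}) \<cong> M" and fin: "finite (carrier M)"
  shows "group M"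
proof -
  interpret monoid M by fact
  obtain \<phi> where onto: "\<phi> ` lists A = carrier M" and one: "\<phi> [] = \<one>\<^bsub>M\<^esub>"
    and mult: "\<And>u v. u \<in> lists A \<Longrightarrow> v \<in> lists A \<Longrightarrow> \<phi> (u @ v) = \<phi> u \<otimes>\<^bsub>M\<^esub> \<phi> v"
    and eq: "\<And>u v. u \<in> lists A \<Longrightarrow> v \<in> lists A \<Longrightarrow>
      \<phi> u = \<phi> v \<longleftrightarrow> (u, v) \<in> pres_cong A (W \<times> {[]})"
    using presented_monoid_isoE[OF \<open>monoid M\<close> iso] by blast
  have closed: "\<phi> u \<in> carrier M" if "u \<in> lists A" for u
    using onto that by blast
  have letter: "\<phi> [a] \<in> Units M" if a: "a \<in> A" for a
  proof -
    have "\<exists>w\<in>W. a \<in> set w"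
    proof (rule ccontr)
      assume "\<not> (\<exists>w\<in>W. a \<in> set w)"
      \<comment> \<open>A relator avoiding \<open>a\<close> has count 0, just like the empty word on
        the other side.\<close>
      then have "count_list u a = count_list v a" if "(u, v) \<in> W \<times> {[]}" for u v
        using that by (auto simp: count_list_0_iff)
      note inv = pres_cong_count_list[OF _ this]
      have pow: "replicate n a \<in> lists A" for n
        using a by auto
      have "inj (\<lambda>n. \<phi> (replicate n a))"
      proof (rule injI)
        fix m n assume "\<phi> (replicate m a) = \<phi> (replicate n a)"
        then have "(replicate m a, replicate n a) \<in> pres_cong A (W \<times> {[]})"
          using eq[OF pow pow] by simp
        from inv[OF this] have
          "count_list (replicate m a) a = count_list (replicate n a) a" .
        moreover have "count_list (replicate k a) a = k" for k
          by (induction k) auto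
        ultimately show "m = n" by simp
      qed
      then have "infinite (range (\<lambda>n. \<phi> (replicate n a)))"
        using finite_imageD by blast
      moreover have "range (\<lambda>n. \<phi> (replicate n a)) \<subseteq> carrier M"
        using closed pow by blast
      ultimately show False
        using fin finite_subset by blast
    qed
    then obtain x y where w: "x @ a # y \<in> W"
      by (metis split_list)
    then have lists: "x \<in> lists A" "[a] \<in> lists A" "y \<in> lists A"
      using W by auto
    have "(x @ a # y, []) \<in> pres_cong A (W \<times> {[]})"
      using w W by (intro pres_cong.base) auto
    then have "\<phi> (x @ [a] @ y) = \<one>\<^bsub>M\<^esub>"
      using eq[of "x @ a # y" "[]"] lists one by simp
    then have "\<phi> x \<otimes>\<^bsub>M\<^esub> (\<phi> [a] \<otimes>\<^bsub>M\<^esub> \<phi> y) = \<one>\<^bsub>M\<^esub>"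
      using mult[of x "[a] @ y"] mult[of "[a]" y] lists by simp
    then show ?thesis
      using finite_monoid_middle_Unit[OF \<open>monoid M\<close> fin] closed lists by blast
  qed
  have "\<phi> w \<in> Units M" if "w \<in> lists A" for w
    using that
  proof (induction w)
    case Nil
    then show ?case using one by simp
  next
    case (Cons a w)
    then have "\<phi> ([a] @ w) = \<phi> [a] \<otimes>\<^bsub>M\<^esub> \<phi> w"
      by (intro mult) auto
    then show ?case
      using Cons letter by simp
  qed
  then have "carrier M \<subseteq> Units M"
    unfolding onto[symmetric] by blast
  then show ?thesis
    by unfold_locales
qed

section \<open>Regular word problems\<close>

lemma foldl_in_states:
  assumes "\<And>q c. q \<in> S \<Longrightarrow> c \<in> \<Sigma> \<Longrightarrow> \<delta> q c \<in> S" "q \<in> S" "w \<in> lists \<Sigma>"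
  shows "foldl \<delta> q w \<in> S"
  using assms(2,3) by (induction w arbitrary: q) (auto simp: assms(1))

text \<open>Permits states of any type and acceptance by a predicate: a finite state set is renamed
  along an injection into the naturals.\<close>

lemma regular_languageI:
  fixes \<delta> :: "'q \<Rightarrow> 'c \<Rightarrow> 'q"
  assumes \<Sigma>: "finite \<Sigma>" and S: "finite S" "q0 \<in> S"
    and step: "\<And>q c. q \<in> S \<Longrightarrow> c \<in> \<Sigma> \<Longrightarrow> \<delta> q c \<in> S"
    and L: "L = {w \<in> lists \<Sigma>. P (foldl \<delta> q0 w)}"
  shows "regular_language \<Sigma> L"
proof -
  obtain f :: "'q \<Rightarrow> nat" where f: "inj_on f S"
    using finite_imp_inj_to_nat_seg[OF S(1)] by blast
  define g where "g = the_inv_into S f"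
  have gf: "g (f q) = q" if "q \<in> S" for q
    using the_inv_into_f_f[OF f that] by (simp add: g_def)
  define d where "d = (\<lambda>n c. f (\<delta> (g n) c))"
  have fold: "foldl d (f q) w = f (foldl \<delta> q w)" if "q \<in> S" "w \<in> lists \<Sigma>" for q w
    using that by (induction w arbitrary: q) (auto simp: d_def gf step)
  have "f (foldl \<delta> q0 w) \<in> f ` {q \<in> S. P q} \<longleftrightarrow> P (foldl \<delta> q0 w)" if "w \<in> lists \<Sigma>" for w
  proof -
    have "foldl \<delta> q0 w \<in> S"
      by (rule foldl_in_states[OF step S(2) that])
    then show ?thesis
      using inj_on_image_mem_iff[OF f, of _ "{q \<in> S. P q}"] by auto
  qed
  then have "L = {w \<in> lists \<Sigma>. foldl d (f q0) w \<in> f ` {q \<in> S. P q}}"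
    unfolding L using fold[OF S(2)] by (metis (no_types, lifting))
  moreover have "d n c \<in> f ` S" if "n \<in> f ` S" "c \<in> \<Sigma>" for n c
    using that step gf by (auto simp: d_def)
  ultimately show ?thesis
    unfolding regular_language_def using \<Sigma> S
    by (intro conjI exI[of _ "f ` S"] exI[of _ "f q0"] exI[of _ "f ` {q \<in> S. P q}"] exI[of _ d])
      auto
qed

text \<open>Tagged letters are never \<open>None\<close>, so the separator fixes the point of
  division and the two words can be read off.\<close>

lemma map_Some_separator_eq_iff:
  "map Some u @ [None] @ map Some v = map Some u' @ [None] @ map Some v' \<longleftrightarrow> u = u' \<and> v = v'"
proof (induction u arbitrary: u')
  case Nil
  show ?case by (cases u') (auto simp: inj_map_eq_map)
next
  case (Cons x u)
  then show ?case by (cases u') auto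
qed

lemma word_problem_iff:
  "map Some u @ [None] @ map Some (rev v) \<in> word_problem M X \<sigma> \<longleftrightarrow>
     u \<in> lists X \<and> v \<in> lists X \<and> word_value M \<sigma> u = word_value M \<sigma> v"
proof -
  have "map Some u @ [None] @ map Some (rev v) \<in> word_problem M X \<sigma> \<longleftrightarrow>
    (\<exists>u' v'. (u = u' \<and> rev v = rev v') \<and>
      u' \<in> lists X \<and> v' \<in> lists X \<and> word_value M \<sigma> u' = word_value M \<sigma> v')"
    unfolding word_problem_def mem_Collect_eq map_Some_separator_eq_iff ..
  then show ?thesis
    unfolding rev_is_rev_conv by blast
qed

section \<open>From regularity to finiteness\<close>

lemma regular_word_problem_imp_finite:
  assumes gen: "generates_monoid M X \<sigma>"
    and reg: "regular_language (insert None (Some ` X)) (word_problem M X \<sigma>)"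
  shows "finite (carrier M)"
proof -
  let ?\<Sigma> = "insert None (Some ` X)"
  obtain Q q0 F \<delta> where Q: "finite (Q :: nat set)" "q0 \<in> Q"
      "\<forall>q\<in>Q. \<forall>c\<in>?\<Sigma>. \<delta> q c \<in> Q"
    and L: "word_problem M X \<sigma> = {w \<in> lists ?\<Sigma>. foldl \<delta> q0 w \<in> F}"
    using reg unfolding regular_language_def by (elim conjE exE) (rule that)
  obtain r where r: "\<And>m. m \<in> carrier M \<Longrightarrow> r m \<in> lists X"
      "\<And>m. m \<in> carrier M \<Longrightarrow> word_value M \<sigma> (r m) = m"
    using gen unfolding generates_monoid_def by metis
  \<comment> \<open>Which continuations are accepted after the chosen word \<open>r m\<close> and
    the separator depends on this state alone.\<close>
  define state where "state = (\<lambda>m. foldl \<delta> q0 (map Some (r m) @ [None]))"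
  have tagged: "map Some w \<in> lists ?\<Sigma>" if "w \<in> lists X" for w
    using that by auto
  have accept: "map Some (r m) @ [None] @ map Some (rev (r n)) \<in> word_problem M X \<sigma> \<longleftrightarrow>
      foldl \<delta> (state m) (map Some (rev (r n))) \<in> F"
    if "m \<in> carrier M" "n \<in> carrier M" for m n
  proof -
    have "map Some (r m) @ [None] @ map Some (rev (r n)) \<in> lists ?\<Sigma>"
      using tagged[OF r(1)[OF that(1)]] tagged[OF r(1)[OF that(2)]] by (auto simp: rev_map)
    then show ?thesis
      unfolding L state_def by simp
  qed
  have "inj_on state (carrier M)"
  proof (rule inj_onI)
    fix m n assume m: "m \<in> carrier M" and n: "n \<in> carrier M" and eq: "state m = state n"
    \<comment> \<open>Reflexivity puts this word in the language; equal states then allow the prefix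
      \<open>r n\<close> to be exchanged for \<open>r m\<close>.\<close>
    have "map Some (r n) @ [None] @ map Some (rev (r n)) \<in> word_problem M X \<sigma>"
      unfolding word_problem_iff using r(1)[OF n] by simp
    then have "map Some (r m) @ [None] @ map Some (rev (r n)) \<in> word_problem M X \<sigma>"
      unfolding accept[OF n n] accept[OF m n] eq .
    then show "m = n"
      unfolding word_problem_iff using r(2) m n by simp
  qed
  moreover have "state ` carrier M \<subseteq> Q"
  proof
    fix q assume "q \<in> state ` carrier M"
    then obtain m where m: "m \<in> carrier M" "q = state m" by blast
    have "map Some (r m) @ [None] \<in> lists ?\<Sigma>"
      using tagged[OF r(1)[OF m(1)]] by simp
    then show "q \<in> Q"
      unfolding m(2) state_def using Q(2,3) by (intro foldl_in_states[of Q ?\<Sigma> \<delta>]) blast+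
  qed
  ultimately show ?thesis
    using Q(1) finite_subset finite_imageD by blast
qed

section \<open>An automaton for the word problem of a finite monoid\<close>

lemma word_value_closed:
  assumes "monoid M" "\<sigma> ` X \<subseteq> carrier M" "w \<in> lists X"
  shows "word_value M \<sigma> w \<in> carrier M"
  using assms(3)
proof (induction w)
  case Nil
  then show ?case using monoid.one_closed[OF assms(1)] by (simp add: word_value_def)
next
  case (Cons x w)
  then show ?case
    using monoid.m_closed[OF assms(1)] assms(2) by (auto simp: word_value_def)
qed

text \<open>\<open>word_value\<close> unfolds at the first letter, whereas the automaton extends the
  word before the separator at its end.\<close>

lemma word_value_snoc:
  assumes "monoid M" "\<sigma> ` X \<subseteq> carrier M" "w \<in> lists X" "x \<in> X"
  shows "word_value M \<sigma> (w @ [x]) = word_value M \<sigma> w \<otimes>\<^bsub>M\<^esub> \<sigma> x"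
proof -
  interpret monoid M by fact
  have x: "\<sigma> x \<in> carrier M" using assms by blast
  show ?thesis using assms(3)
  proof (induction w)
    case Nil
    then show ?case using x by (simp add: word_value_def)
  next
    case (Cons y w)
    have "word_value M \<sigma> w \<in> carrier M" "\<sigma> y \<in> carrier M"
      using word_value_closed[OF assms(1,2)] Cons assms(2) by auto
    then show ?case
      using Cons x by (simp add: word_value_def m_assoc)
  qed
qed

text \<open>State \<open>Some (m, None)\<close>: the letters read so far have the value \<open>m\<close>.
  State \<open>Some (m, Some n)\<close>: the separator has been passed, \<open>m\<close> is the value of the word before it
  and \<open>n\<close> that of the reversal of the word after it.
  State \<open>None\<close>: a second separator has been read.\<close>

fun wp_step :: "('m, 'b) monoid_scheme \<Rightarrow> ('x \<Rightarrow> 'm) \<Rightarrow>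
    ('m \<times> 'm option) option \<Rightarrow> 'x option \<Rightarrow> ('m \<times> 'm option) option"
where
  "wp_step M \<sigma> (Some (m, None)) (Some x) = Some (m \<otimes>\<^bsub>M\<^esub> \<sigma> x, None)"
| "wp_step M \<sigma> (Some (m, None)) None = Some (m, Some \<one>\<^bsub>M\<^esub>)"
| "wp_step M \<sigma> (Some (m, Some n)) (Some x) = Some (m, Some (\<sigma> x \<otimes>\<^bsub>M\<^esub> n))"
| "wp_step M \<sigma> _ _ = None"

lemma wp_step_prefix:
  assumes "monoid M" "\<sigma> ` X \<subseteq> carrier M" "u \<in> lists X"
  shows "foldl (wp_step M \<sigma>) (Some (\<one>\<^bsub>M\<^esub>, None)) (map Some u) = Some (word_value M \<sigma> u, None)"
  using assms(3)
proof (induction u rule: rev_induct)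
  case Nil
  then show ?case by (simp add: word_value_def)
next
  case (snoc x u)
  then show ?case by (simp add: word_value_snoc[OF assms(1,2)])
qed

text \<open>The reversed word delivers the last letter of \<open>v\<close> first, so multiplying
  each letter on the left retraces the \<open>foldr\<close> in \<open>word_value\<close>.\<close>

lemma wp_step_suffix:
  "foldl (wp_step M \<sigma>) (Some (m, Some \<one>\<^bsub>M\<^esub>)) (map Some (rev v)) = Some (m, Some (word_value M \<sigma> v))"
  by (induction v) (simp_all add: word_value_def)

lemma wp_step_None: "foldl (wp_step M \<sigma>) None w = None"
  by (induction w) simp_all

lemma no_separator_or_split:
  assumes "w \<in> lists (insert None (Some ` X))"
  obtains (word) u where "u \<in> lists X" "w = map Some u"
  | (split) u w' where "u \<in> lists X" "w' \<in> lists (insert None (Some ` X))"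
      "w = map Some u @ [None] @ w'"
proof -
  have "(\<exists>u\<in>lists X. w = map Some u) \<or>
    (\<exists>u\<in>lists X. \<exists>w'\<in>lists (insert None (Some ` X)). w = map Some u @ [None] @ w')"
    using assms
  proof (induction w)
    case Nil
    then show ?case by simp
  next
    case (Cons c w)
    show ?case
    proof (cases c)
      case None
      then show ?thesis using Cons.hyps by (intro disjI2 bexI[of _ "[]"] bexI[of _ w]) auto
    next
      case (Some x)
      then have x: "x \<in> X" using Cons.hyps by auto
      from Cons.IH show ?thesis
      proof
        assume "\<exists>u\<in>lists X. w = map Some u"
        then obtain u where "u \<in> lists X" "w = map Some u" by blast
        then show ?thesis using Some x by (intro disjI1 bexI[of _ "x # u"]) auto
      next
        assume "\<exists>u\<in>lists X. \<exists>w'\<in>lists (insert None (Some ` X)). w = map Some u @ [None] @ w'"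
        then obtain u w' where "u \<in> lists X" "w' \<in> lists (insert None (Some ` X))"
          "w = map Some u @ [None] @ w'" by blast
        then show ?thesis
          using Some x by (intro disjI2 bexI[of _ "x # u"] bexI[of _ w']) auto
      qed
    qed
  qed
  then show thesis using word split by blast
qed

text \<open>Dividing at the first separator, and the remainder at the next, leaves words with none,
  one or at least two; these end in the three kinds of state.\<close>

lemma wp_step_accepts_iff:
  assumes "monoid M" "\<sigma> ` X \<subseteq> carrier M" and w: "w \<in> lists (insert None (Some ` X))"
  shows "w \<in> word_problem M X \<sigma> \<longleftrightarrow>
    (\<exists>m. foldl (wp_step M \<sigma>) (Some (\<one>\<^bsub>M\<^esub>, None)) w = Some (m, Some m))"
  using w
proof (cases rule: no_separator_or_split)
  case (word u)
  then have "None \<notin> set w" by auto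
  then have "w \<notin> word_problem M X \<sigma>" by (auto simp: word_problem_def)
  then show ?thesis using word by (simp add: wp_step_prefix[OF assms(1,2)])
next
  case (split u w')
  note outer = split
  show ?thesis using split(2)
  proof (cases rule: no_separator_or_split)
    case (word v)
    \<comment> \<open>The letters \<open>v\<close> after the separator are the reversal of the word
      to be compared with \<open>u\<close>, which is therefore \<open>rev v\<close>.\<close>
    then have "w = map Some u @ [None] @ map Some (rev (rev v))"
      using outer by simp
    then show ?thesis
      using outer(1) word(1) wp_step_suffix[of M \<sigma> "word_value M \<sigma> u" "rev v"]
        word_problem_iff[of u "rev v" M X \<sigma>]
      by (auto simp: wp_step_prefix[OF assms(1,2)])
  next
    case (split v w'')
    \<comment> \<open>Members of the word problem contain exactly one separator, and the automaton
      is trapped in \<open>None\<close> from the second one on.\<close>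
    have "count_list w None \<ge> 2"
      using outer split by simp
    moreover have "count_list (map Some s @ [None] @ map Some t) None = 1" for s t :: "'c list"
      by (simp add: count_list_0_iff)
    ultimately have "w \<notin> word_problem M X \<sigma>"
      by (auto simp: word_problem_def count_list_0_iff)
    moreover have "foldl (wp_step M \<sigma>) (Some (\<one>\<^bsub>M\<^esub>, None)) w = None"
      using outer split wp_step_suffix[of M \<sigma> "word_value M \<sigma> u" "rev v"]
      by (simp add: wp_step_prefix[OF assms(1,2)] wp_step_None)
    ultimately show ?thesis by simp
  qed
qed

lemma finite_imp_regular_word_problem:
  assumes "monoid M" and fin: "finite (carrier M)" and "finite X" and \<sigma>: "\<sigma> ` X \<subseteq> carrier M"
  shows "regular_language (insert None (Some ` X)) (word_problem M X \<sigma>)"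
proof (rule regular_languageI)
  interpret monoid M by fact
  let ?\<Sigma> = "insert None (Some ` X)"
  let ?S = "insert None (Some ` (carrier M \<times> insert None (Some ` carrier M)))"
  show "finite ?\<Sigma>" "finite ?S" "Some (\<one>\<^bsub>M\<^esub>, None) \<in> ?S"
    using fin \<open>finite X\<close> by auto
  show "wp_step M \<sigma> q c \<in> ?S" if "q \<in> ?S" "c \<in> ?\<Sigma>" for q c
    using that \<sigma> by (cases "(M, \<sigma>, q, c)" rule: wp_step.cases) auto
  have "word_problem M X \<sigma> \<subseteq> lists ?\<Sigma>"
    by (auto simp: word_problem_def)
  then show "word_problem M X \<sigma> =
      {w \<in> lists ?\<Sigma>. \<exists>m. foldl (wp_step M \<sigma>) (Some (\<one>\<^bsub>M\<^esub>, None)) w = Some (m, Some m)}"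
    using wp_step_accepts_iff[OF \<open>monoid M\<close> \<sigma>] by blast
qed

theorem proposition3p6:
  fixes M :: "('m, 'b) monoid_scheme"
    and A :: "'a set" and W :: "'a list set"
    and X :: "'x set" and \<sigma> :: "'x \<Rightarrow> 'm"
  assumes "monoid M"
    and "finite A" and "finite W" and "W \<subseteq> lists A"
    and "presented_monoid A (W \<times> {[]}) \<cong> M"
    and "finite X" and "generates_monoid M X \<sigma>"
  shows "regular_language (insert None (Some ` X)) (word_problem M X \<sigma>) \<longleftrightarrow>
           group M \<and> finite (carrier M)"
proof
  assume "regular_language (insert None (Some ` X)) (word_problem M X \<sigma>)"
  then have "finite (carrier M)"
    by (rule regular_word_problem_imp_finite[OF assms(7)])
  then show "group M \<and> finite (carrier M)"
    using finite_special_monoid_group assms(1,4,5) by blast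
next
  assume "group M \<and> finite (carrier M)"
  then show "regular_language (insert None (Some ` X)) (word_problem M X \<sigma>)"
    using finite_imp_regular_word_problem assms(1,6,7) unfolding generates_monoid_def by blast
qed

end
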